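(* Let $M$ be an $\mathbb{O}$-bimodule. Then the right multiplication is uniquely determined by the left module structure of $M$. More precisely, for any $x\in M$, the right multiplication is given by $$xe_i=e_ix-\frac14\sum_{j,k=1}^7\epsilon_{ijk}[e_j,e_k,x],\qquad i=1,\ldots,7.$$
   Context: $\mathbb{O}$ is the real division algebra of octonions with its standard real basis $1,e_1,\ldots,e_7$ multiplied according to the Fano plane; the symbols $\epsilon_{ijk}\in\{0,\pm1\}$ ($1\le i,j,k\le7$) are the totally skew-symmetric structure constants given by $e_ie_j=\sum_{k}\epsilon_{ijk}e_k-\delta_{ij}$. A left $\mathbb{O}$-module is a real vector space $M$ with an $\mathbb{R}$-bilinear map $\mathbb{O}\times M\to M$, $(p,m)\mapsto pm$, such that $1m=m$ and $[p,q,m]=-[q,p,m]$ for all $p,q\in\mathbb{O}$, $m\in M$, where $[p,q,m]:=(pq)m-p(qm)$. An $\mathbb{O}$-bimodule is a left $\mathbb{O}$-module $M$ with in addition an $\mathbb{R}$-bilinear right multiplication $M\times\mathbb{O}\to M$, $(m,p)\mapsto mp$, with $m1=m$, such that $[p,q,m]=[m,p,q]=[q,m,p]$ for all $p,q\in\mathbb{O}$, $m\in M$, where $[m,p,q]:=(mp)q-m(pq)$ and $[q,m,p]:=(qm)p-q(mp)$. *)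

theory Defs
  imports "HOL-Analysis.Linear_Algebra"
begin

text \<open>An octonion is given by its coordinates with respect to $1 = e_0, e_1, \ldots, e_7$.\<close>

typedef octonion = "{f :: nat \<Rightarrow> real. \<forall>n>7. f n = 0}"
  morphisms octo_coord Abs_octonion
  by (rule exI[of _ "\<lambda>_. 0"]) simp

setup_lifting type_definition_octonion

instantiation octonion :: real_vector
begin

lift_definition zero_octonion :: octonion is "\<lambda>_. 0" by simp
lift_definition plus_octonion :: "octonion \<Rightarrow> octonion \<Rightarrow> octonion"
  is "\<lambda>f g n. f n + g n" by simp
lift_definition minus_octonion :: "octonion \<Rightarrow> octonion \<Rightarrow> octonion"
  is "\<lambda>f g n. f n - g n" by simp
lift_definition uminus_octonion :: "octonion \<Rightarrow> octonion"
  is "\<lambda>f n. - f n" by simp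
lift_definition scaleR_octonion :: "real \<Rightarrow> octonion \<Rightarrow> octonion"
  is "\<lambda>r f n. r * f n" by simp

instance
  by standard (transfer; auto simp: fun_eq_iff algebra_simps)+

end

lift_definition octo_unit :: "nat \<Rightarrow> octonion"
  is "\<lambda>i n. if n = i \<and> n \<le> 7 then 1 else 0" by simp

text \<open>The lines of the Fano plane, oriented so that $e_i e_j = e_k$ for $(i,j,k)$ in the list.\<close>

definition fano_lines :: "(nat \<times> nat \<times> nat) set" where
  "fano_lines = {(1,2,3), (1,4,5), (1,7,6), (2,4,6), (2,5,7), (3,4,7), (3,6,5)}"

definition octo_eps :: "nat \<Rightarrow> nat \<Rightarrow> nat \<Rightarrow> real" where
  "octo_eps i j k =
    (if (i,j,k) \<in> fano_lines \<or> (j,k,i) \<in> fano_lines \<or> (k,i,j) \<in> fano_lines then 1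
     else if (j,i,k) \<in> fano_lines \<or> (i,k,j) \<in> fano_lines \<or> (k,j,i) \<in> fano_lines then -1
     else 0)"

lemma octo_eps_skew:
  "octo_eps j i k = - octo_eps i j k" "octo_eps i k j = - octo_eps i j k"
proof -
  have "\<not> ((j,i,k) \<in> fano_lines \<or> (i,k,j) \<in> fano_lines \<or> (k,j,i) \<in> fano_lines)"
    if "(i,j,k) \<in> fano_lines \<or> (j,k,i) \<in> fano_lines \<or> (k,i,j) \<in> fano_lines"
    using that unfolding fano_lines_def by (elim disjE insertE emptyE) simp_all
  then show "octo_eps j i k = - octo_eps i j k" "octo_eps i k j = - octo_eps i j k"
    unfolding octo_eps_def by argo+
qed

lemma octo_eps_eq_0: "\<not> k \<le> 7 \<Longrightarrow> octo_eps i j k = 0"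
  by (auto simp: octo_eps_def fano_lines_def)

text \<open>The bilinear extension of $e_i e_j = \sum_k \epsilon_{ijk} e_k - \delta_{ij}$,
  with $e_0$ as the identity; see \<open>octo_unit_mult\<close> below.  The product is not associative, so
  none of the library's ring classes applies.\<close>

instantiation octonion :: "{one, times}"
begin

definition one_octonion :: octonion where "1 = octo_unit 0"

lift_definition times_octonion :: "octonion \<Rightarrow> octonion \<Rightarrow> octonion"
  is "\<lambda>p q n. if n = 0 then p 0 * q 0 - (\<Sum>i=1..7. p i * q i)
              else p 0 * q n + p n * q 0 + (\<Sum>i=1..7. \<Sum>j=1..7. octo_eps i j n * p i * q j)"
  by (auto simp: octo_eps_eq_0)

instance ..

end

lemma octo_coord_sum: "octo_coord (sum f A) n = (\<Sum>a\<in>A. octo_coord (f a) n)"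
  by (induction A rule: infinite_finite_induct)
    (simp_all add: zero_octonion.rep_eq plus_octonion.rep_eq)

lemma octo_coord_unit: "i \<le> 7 \<Longrightarrow> octo_coord (octo_unit i) n = (if n = i then 1 else 0)"
  by (simp add: octo_unit.rep_eq)

lemma bilinear_octo_mult: "bilinear ((*) :: octonion \<Rightarrow> octonion \<Rightarrow> octonion)"
  unfolding bilinear_def linear_iff
  by (intro conjI allI; transfer)
    (auto simp: fun_eq_iff algebra_simps sum.distrib sum_distrib_left)

lemma octo_mult_1: "1 * p = p" "p * 1 = (p :: octonion)"
  unfolding one_octonion_def by (transfer; auto simp: fun_eq_iff)+

lemma octo_unit_mult:
  assumes "i \<in> {1..7}" "j \<in> {1..7}"
  shows "octo_unit i * octo_unit j =
    (\<Sum>k=1..7. octo_eps i j k *\<^sub>R octo_unit k) - (if i = j then 1 else 0)"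
proof -
  have [simp]: "(\<Sum>a=1..7. \<Sum>b=1..7. octo_eps a b n * octo_coord (octo_unit i) a
      * octo_coord (octo_unit j) b) = octo_eps i j n" for n
  proof -
    have "(\<Sum>a=1..7. \<Sum>b=1..7. octo_eps a b n * octo_coord (octo_unit i) a
        * octo_coord (octo_unit j) b)
      = (\<Sum>a=1..7. \<Sum>b=1..7. if b = j then if a = i then octo_eps i j n else 0 else 0)"
      using assms by (intro sum.cong) (auto simp: octo_coord_unit)
    then show ?thesis using assms by simp
  qed
  have [simp]: "(\<Sum>a=1..7. octo_coord (octo_unit i) a * octo_coord (octo_unit j) a)
      = (if i = j then 1 else 0)"
  proof -
    have "(\<Sum>a=1..7. octo_coord (octo_unit i) a * octo_coord (octo_unit j) a)
       = (\<Sum>a=1..7. if a = i then if i = j then 1 else 0 else 0)"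
      using assms by (intro sum.cong) (auto simp: octo_coord_unit)
    then show ?thesis using assms by simp
  qed
  have [simp]: "(\<Sum>k=1..7. octo_eps i j k * octo_coord (octo_unit k) n)
      = (if n = 0 then 0 else octo_eps i j n)" for n
  proof -
    have "(\<Sum>k=1..7. octo_eps i j k * octo_coord (octo_unit k) n)
       = (\<Sum>k=1..7. if k = n then octo_eps i j n else 0)"
      by (intro sum.cong) (auto simp: octo_coord_unit)
    then show ?thesis by (auto simp: octo_eps_eq_0)
  qed
  have [simp]: "octo_coord (octo_unit i) 0 = 0" "octo_coord (octo_unit j) 0 = 0"
    using assms by (auto simp: octo_coord_unit)
  have [simp]: "octo_coord (if i = j then 1 else 0) n = (if n = 0 then if i = j then 1 else 0 else 0)"
    for n
    by (simp add: one_octonion_def octo_coord_unit zero_octonion.rep_eq)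
  have "octo_coord (octo_unit i * octo_unit j) n =
      octo_coord ((\<Sum>k=1..7. octo_eps i j k *\<^sub>R octo_unit k) - (if i = j then 1 else 0)) n" for n
    by (cases "n = 0")
      (simp_all add: times_octonion.rep_eq minus_octonion.rep_eq octo_coord_sum
        scaleR_octonion.rep_eq del: One_nat_def split del: if_split)
  then show ?thesis
    by (simp add: octo_coord_inject[symmetric] fun_eq_iff)
qed

text \<open>The real vector space underlying a module is the whole type \<open>'m\<close>;
  \<open>lm p m\<close> is $pm$ and \<open>rm m p\<close> is $mp$.\<close>

definition left_assoc :: "(octonion \<Rightarrow> 'm \<Rightarrow> 'm) \<Rightarrow> octonion \<Rightarrow> octonion \<Rightarrow> 'm \<Rightarrow> 'm::real_vector" where
  "left_assoc lm p q m = lm (p * q) m - lm p (lm q m)"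

definition right_assoc :: "('m \<Rightarrow> octonion \<Rightarrow> 'm) \<Rightarrow> 'm \<Rightarrow> octonion \<Rightarrow> octonion \<Rightarrow> 'm::real_vector" where
  "right_assoc rm m p q = rm (rm m p) q - rm m (p * q)"

definition mid_assoc ::
  "(octonion \<Rightarrow> 'm \<Rightarrow> 'm) \<Rightarrow> ('m \<Rightarrow> octonion \<Rightarrow> 'm) \<Rightarrow> octonion \<Rightarrow> 'm \<Rightarrow> octonion \<Rightarrow> 'm::real_vector" where
  "mid_assoc lm rm q m p = rm (lm q m) p - lm q (rm m p)"

locale octonion_left_module =
  fixes lm :: "octonion \<Rightarrow> 'm::real_vector \<Rightarrow> 'm"
  assumes bilinear_lm: "bilinear lm"
    and lm_one: "lm 1 m = m"
    and left_assoc_skew: "left_assoc lm p q m = - left_assoc lm q p m"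

locale octonion_bimodule = octonion_left_module lm
  for lm :: "octonion \<Rightarrow> 'm::real_vector \<Rightarrow> 'm" +
  fixes rm :: "'m \<Rightarrow> octonion \<Rightarrow> 'm"
  assumes bilinear_rm: "bilinear rm"
    and rm_one: "rm m 1 = m"
    and left_assoc_eq_right_assoc: "left_assoc lm p q m = right_assoc rm m p q"
    and right_assoc_eq_mid_assoc: "right_assoc rm m p q = mid_assoc lm rm q m p"

end

theory Submission imports Defs begin

text \<open>
  In the split null extension of the octonions by the bimodule all associators containing $x$
  alternate.  Linearising $[a^2,b,c] = a[a,b,c] + [a,b,c]a$ to
  \[ [ax + xa,b,c] = a[x,b,c] + [x,b,c]a + x[a,b,c] + [b,c,a]x \]
  and choosing $a, b, c$ among the $e_j$ with $(ab)c = -a(bc) = e_i$, so that the octonion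
  associators equal $2e_i$, gives an equation in which $xe_i$ is the only right product that remains
  after commuting left and right multiplications.
\<close>

lemma octo_unit_mult_line:
  assumes "(i, j, k) \<in> fano_lines"
  shows "octo_unit i * octo_unit j = octo_unit k" "octo_unit j * octo_unit i = - octo_unit k"
    "octo_unit j * octo_unit k = octo_unit i" "octo_unit k * octo_unit j = - octo_unit i"
    "octo_unit k * octo_unit i = octo_unit j" "octo_unit i * octo_unit k = - octo_unit j"
proof -
  \<comment> \<open>The hypothesis is invariant under cyclic shifts of \<open>(p, q, r)\<close>, so
    the three rotations of one line give all six products.\<close>
  have mult: "octo_unit p * octo_unit q = octo_unit r \<and> octo_unit q * octo_unit p = - octo_unit r"
    if line: "(p, q, r) \<in> fano_lines \<or> (q, r, p) \<in> fano_lines \<or> (r, p, q) \<in> fano_lines"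
    for p q r
  proof -
    have pqr: "p \<in> {1..7}" "q \<in> {1..7}" "r \<in> {1..7}" "p \<noteq> q"
      using line by (auto simp: fano_lines_def)
    have eps: "octo_eps p q n = (if n = r then 1 else 0)" for n
      using line unfolding fano_lines_def
      by (elim disjE insertE emptyE) (simp_all add: octo_eps_def fano_lines_def)
    have "(\<Sum>n=1..7. octo_eps p q n *\<^sub>R octo_unit n) = octo_unit r"
      using pqr(3) by (simp add: eps if_distrib[of "\<lambda>c. c *\<^sub>R _"] cong: if_cong)
    then show ?thesis
      using pqr octo_unit_mult[of p q] octo_unit_mult[of q p]
      by (simp add: octo_eps_skew(1)[of q p] sum_negf)
  qed
  show "octo_unit i * octo_unit j = octo_unit k" "octo_unit j * octo_unit i = - octo_unit k"
    "octo_unit j * octo_unit k = octo_unit i" "octo_unit k * octo_unit j = - octo_unit i"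
    "octo_unit k * octo_unit i = octo_unit j" "octo_unit i * octo_unit k = - octo_unit j"
    using assms mult by blast+
qed

lemma octonion_expansion: "p = (\<Sum>i\<le>7. octo_coord p i *\<^sub>R octo_unit i)"
proof -
  have "octo_coord p n = octo_coord (\<Sum>i\<le>7. octo_coord p i *\<^sub>R octo_unit i) n" for n
  proof -
    have "(\<Sum>i\<le>7. octo_coord p i * octo_coord (octo_unit i) n)
      = (\<Sum>i\<le>7. if i = n then octo_coord p n else 0)"
      by (intro sum.cong) (auto simp: octo_coord_unit)
    then show ?thesis
      using octo_coord[of p] by (auto simp: octo_coord_sum scaleR_octonion.rep_eq)
  qed
  then show ?thesis
    by (intro octo_coord_inject[THEN iffD1] ext)
qed

context octonion_bimodule
begin

lemmas lm_linear =
  bilinear_ladd[OF bilinear_lm] bilinear_radd[OF bilinear_lm]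
  bilinear_lsub[OF bilinear_lm] bilinear_rsub[OF bilinear_lm]
  bilinear_lneg[OF bilinear_lm] bilinear_rneg[OF bilinear_lm]
  bilinear_lmul[OF bilinear_lm] bilinear_rmul[OF bilinear_lm]

lemmas rm_linear =
  bilinear_ladd[OF bilinear_rm] bilinear_radd[OF bilinear_rm]
  bilinear_lsub[OF bilinear_rm] bilinear_rsub[OF bilinear_rm]
  bilinear_lneg[OF bilinear_rm] bilinear_rneg[OF bilinear_rm]
  bilinear_lmul[OF bilinear_rm] bilinear_rmul[OF bilinear_rm]

text \<open>Equality of the three associators gives [p,m,q] = [q,p,m]. A right multiplication can
  thus be moved inside a left one, at the cost of left products only.\<close>

lemma rm_lm: "rm (lm p m) q = lm p (rm m q) + left_assoc lm q p m"
  using left_assoc_eq_right_assoc[of q p m] right_assoc_eq_mid_assoc[of m q p]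
  by (simp add: mid_assoc_def)

lemma left_assoc_radd: "left_assoc lm p q (m + n) = left_assoc lm p q m + left_assoc lm p q n"
  by (simp add: left_assoc_def lm_linear)

lemma left_assoc_anticommutator:
  "left_assoc lm b c (lm a x + rm x a) =
    lm a (left_assoc lm b c x) + rm (left_assoc lm b c x) a
    + rm x ((a * b) * c - a * (b * c)) + lm ((b * c) * a - b * (c * a)) x"
proof -
  let ?L = "left_assoc lm" and ?R = "right_assoc rm" and ?M = "mid_assoc lm rm"
  note add_eqs = arg_cong2[where f = "(+)"]
  note defs = left_assoc_def right_assoc_def mid_assoc_def lm_linear rm_linear
  note alt = right_assoc_eq_mid_assoc[symmetric] left_assoc_eq_right_assoc[symmetric]
  \<comment> \<open>Instances of $[pq,r,s] - [p,qr,s] + [p,q,rs] = p[q,r,s] + [p,q,r]s$, which holds without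
    any associativity, for the arguments of \<open>[a\<^sup>2,b,c] = a[a,b,c] + [a,b,c]a\<close>
    with one \<open>a\<close> replaced by \<open>x\<close>.\<close>
  have t1: "?R (lm a x) b c - ?M a (rm x b) c + ?M a x (b * c) = lm a (?R x b c) + rm (?M a x b) c"
    by (simp add: defs)
  have t2: "?R (rm x a) b c - ?R x (a * b) c + ?R x a (b * c)
      = rm x ((a * b) * c - a * (b * c)) + rm (?R x a b) c"
    by (simp add: defs)
  have t3: "?M (c * a) x b - ?M c (lm a x) b + ?L c a (rm x b)
      = lm c (?M a x b) + rm (?L c a x) b"
    by (simp add: defs)
  have t4: "?R (lm c x) a b - ?M c (rm x a) b + ?M c x (a * b)
      = lm c (?R x a b) + rm (?M c x a) b"
    by (simp add: defs)
  have t5: "?L (b * c) a x - ?L b (c * a) x + ?L b c (lm a x)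
      = lm b (?L c a x) + lm ((b * c) * a - b * (c * a)) x"
    by (simp add: defs)
  have t6: "?M (b * c) x a - ?M b (lm c x) a + ?L b c (rm x a)
      = lm b (?M c x a) + rm (?L b c x) a"
    by (simp add: defs)
  \<comment> \<open>On the left only [b,c,ax] and [b,c,xa] survive the addition: each occurs with
    signs +, -, +. All other associators cancel in pairs by alternation.\<close>
  show ?thesis
    using add_eqs[OF add_eqs[OF add_eqs[OF t1 t2] add_eqs[OF t3 t4]] add_eqs[OF t5 t6]]
    by (simp add: alt left_assoc_skew[of b a x] left_assoc_skew[of c a x]
        left_assoc_skew[of "b * c" a x] left_assoc_radd lm_linear rm_linear algebra_simps)
qed

text \<open>In each associator on the left the two octonions multiply to \<open>d\<close>. For the
  units chosen in \<open>rm_octo_unit\<close> they span the three Fano lines through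
  \<open>d\<close>.\<close>

lemma left_assoc_sum:
  assumes "b * a = - (a * b)" "c * a = - (a * c)"
    and "(a * b) * c = d" "b * (a * c) = d" "(b * c) * a = d" "a * (b * c) = - d"
  shows "left_assoc lm (b * c) a x + left_assoc lm b (a * c) x + left_assoc lm (a * b) c x
    = 2 *\<^sub>R (lm d x - rm x d)"
proof -
  \<comment> \<open>Skew symmetry in the first two arguments says p(ay) + a(py) = (pa +
    ap)y.\<close>
  have anti: "lm a (lm p y) = - lm p (lm a y)" if "p * a = - (a * p)" for p y
    using left_assoc_skew[of p a y] that by (simp add: left_assoc_def lm_linear)
  have anti_bc: "lm a (lm (b * c) y) = - lm (b * c) (lm a y)" for y
    using anti[of "b * c"] assms(5,6) by simp
  \<comment> \<open>Rewriting with this pushes right multiplications down to \<open>x\<close>; the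
    terms containing \<open>rm x a\<close> then agree on both sides and only \<open>rm x d\<close>
    is left.\<close>
  have rl: "rm (lm p m) q = lm p (rm m q) + lm (q * p) m - lm q (lm p m)" for p q m
    using rm_lm[of p m q] by (simp add: left_assoc_def)
  have "b * (c * a) = - d"
    using assms by (simp add: bilinear_rneg[OF bilinear_octo_mult])
  then have "left_assoc lm b c (lm a x + rm x a) =
    lm a (left_assoc lm b c x) + rm (left_assoc lm b c x) a + (rm x (d + d) + lm (d + d) x)"
    using left_assoc_anticommutator[of b c a x] assms by simp
  then show ?thesis
    unfolding left_assoc_def
    by (simp add: assms(3-6) anti[OF assms(1)] anti[OF assms(2)] anti_bc rl
        lm_linear rm_linear scaleR_2 algebra_simps)
qed

lemma rm_octo_unit:
  assumes "i \<in> {1..7}"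
  shows "rm x (octo_unit i) = lm (octo_unit i) x
    - (1/4) *\<^sub>R (\<Sum>j=1..7. \<Sum>k=1..7.
        octo_eps i j k *\<^sub>R left_assoc lm (octo_unit j) (octo_unit k) x)"
    (is "_ = _ - (1/4) *\<^sub>R ?S i")
proof -
  have int: "{1..7::nat} = {1,2,3,4,5,6,7}" by auto
  have lines: "(1,2,3) \<in> fano_lines" "(1,4,5) \<in> fano_lines" "(1,7,6) \<in> fano_lines"
    "(2,4,6) \<in> fano_lines" "(2,5,7) \<in> fano_lines" "(3,4,7) \<in> fano_lines" "(3,6,5) \<in> fano_lines"
    by (simp_all add: fano_lines_def)
  note table = lines[THEN octo_unit_mult_line(1)] lines[THEN octo_unit_mult_line(2)]
    lines[THEN octo_unit_mult_line(3)] lines[THEN octo_unit_mult_line(4)]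
    lines[THEN octo_unit_mult_line(5)] lines[THEN octo_unit_mult_line(6)]
  have reorder: "left_assoc lm (octo_unit p) (octo_unit q) x
      = - left_assoc lm (octo_unit q) (octo_unit p) x" if "q < p" for p q
    by (rule left_assoc_skew)
  \<comment> \<open>For each \<open>d\<close> the triple \<open>a, b, c\<close> is chosen so that $(e_a e_b) e_c = e_d$ and
    $e_a e_c = e_p$, $e_b e_c = e_q$, $e_a e_b = e_r$ all carry a positive sign.\<close>
  have sum: "4 *\<^sub>R (lm (octo_unit d) x - rm x (octo_unit d)) =
      2 *\<^sub>R (left_assoc lm (octo_unit q) (octo_unit a) x
        + left_assoc lm (octo_unit b) (octo_unit p) x + left_assoc lm (octo_unit r) (octo_unit c) x)"
    if "(a, b, c, d, p, q, r) \<in> {(3,4,6,1,5,2,7), (1,4,7,2,6,3,5), (2,4,5,3,7,1,6),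
      (1,7,2,4,3,5,6), (2,3,4,5,6,7,1), (3,1,4,6,7,5,2), (1,2,4,7,5,6,3)}" for a b c d p q r
  proof -
    have "left_assoc lm (octo_unit q) (octo_unit a) x
        + left_assoc lm (octo_unit b) (octo_unit p) x + left_assoc lm (octo_unit r) (octo_unit c) x
      = 2 *\<^sub>R (lm (octo_unit d) x - rm x (octo_unit d))"
      using that left_assoc_sum[of "octo_unit b" "octo_unit a" "octo_unit c" "octo_unit d" x]
      by (elim insertE emptyE)
        (simp_all add: table bilinear_rneg[OF bilinear_octo_mult] del: One_nat_def)
    then show ?thesis by simp
  qed
  \<comment> \<open>The double sum meets each line through e_i in both orders of its other two
    points. Both orders contribute equally, as \<open>octo_eps\<close> and the associator change
    sign together; this 2 and the 2 of \<open>left_assoc_sum\<close> make the 4.\<close>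
  have "?S i = 4 *\<^sub>R (lm (octo_unit i) x - rm x (octo_unit i))"
    using assms unfolding int
    by (elim insertE emptyE)
      (simp_all add: sum octo_eps_def fano_lines_def reorder scaleR_2 del: One_nat_def)
  then show ?thesis by simp
qed

end

theorem corollary4p2:
  fixes lm :: "octonion \<Rightarrow> 'm::real_vector \<Rightarrow> 'm"
    and rm :: "'m \<Rightarrow> octonion \<Rightarrow> 'm"
  assumes "octonion_bimodule lm rm"
  shows "(\<forall>rm'. octonion_bimodule lm rm' \<longrightarrow> rm' = rm) \<and>
    (\<forall>x. \<forall>i\<in>{1..7}. rm x (octo_unit i) =
       lm (octo_unit i) x
       - (1/4) *\<^sub>R (\<Sum>j=1..7. \<Sum>k=1..7.
            octo_eps i j k *\<^sub>R left_assoc lm (octo_unit j) (octo_unit k) x))"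
proof (intro conjI allI impI ballI)
  interpret octonion_bimodule lm rm by fact
  fix rm' assume "octonion_bimodule lm rm'"
  then interpret r': octonion_bimodule lm rm' .
  \<comment> \<open>For imaginary units both right multiplications equal the same expression in
    \<open>lm\<close> alone; e_0 is the identity.\<close>
  have unit: "rm' x (octo_unit i) = rm x (octo_unit i)" if "i \<le> 7" for x i
  proof (cases "i = 0")
    case True
    then show ?thesis
      using rm_one[of x] r'.rm_one[of x] by (simp add: one_octonion_def)
  next
    case False
    then show ?thesis
      using that by (simp add: rm_octo_unit r'.rm_octo_unit)
  qed
  show "rm' = rm"
  proof (intro ext)
    fix x p
    have lin: "linear (rm x)" "linear (rm' x)"
      using bilinear_rm r'.bilinear_rm by (simp_all add: bilinear_def)
    have "rm' x (\<Sum>i\<le>7. octo_coord p i *\<^sub>R octo_unit i)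
        = rm x (\<Sum>i\<le>7. octo_coord p i *\<^sub>R octo_unit i)"
      by (simp add: lin linear_sum linear_cmul unit)
    then show "rm' x p = rm x p"
      by (simp flip: octonion_expansion)
  qed
qed (rule octonion_bimodule.rm_octo_unit[OF assms])

end
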